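(* Let $ABCD$ be a convex quadrilateral and let $E$ be any point in its plane not lying on a sideline of the quadrilateral (that is, not on any of the lines $AB$, $BC$, $CD$, $DA$). Let $F$, $G$, $H$, and $I$ be the centroids of $\triangle EAB$, $\triangle EBC$, $\triangle ECD$, and $\triangle EDA$, respectively. Then $FGHI$ is a parallelogram and $$[ABCD]=\frac92[FGHI].$$
   Context: $[XYZW]$ denotes the area of the quadrilateral $XYZW$; in general it is the signed area $[XYZW]=[XYZ]+[ZWX]$, the sum of signed areas of triangles (orientation taken positive for the orientation of $ABCD$). *)

theory Defs
  imports "HOL-Analysis.Analysis"
begin

text \<open>The strict form ``each sideline leaves the opposite side strictly in one open
  half-plane'': two points lie strictly on the same side of a line iff the segment joining them
  misses that line.  This forces the four vertices to be distinct, no three of them collinear, and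
  excludes self-intersecting vertex orders.\<close>

definition convex_quadrilateral ::
    "real ^ 2 \<Rightarrow> real ^ 2 \<Rightarrow> real ^ 2 \<Rightarrow> real ^ 2 \<Rightarrow> bool"
  where "convex_quadrilateral A B C D \<longleftrightarrow>
    affine hull {A, B} \<inter> closed_segment C D = {} \<and>
    affine hull {B, C} \<inter> closed_segment D A = {} \<and>
    affine hull {C, D} \<inter> closed_segment A B = {} \<and>
    affine hull {D, A} \<inter> closed_segment B C = {}"

text \<open>Degenerate (flat) parallelograms are not admitted.\<close>

definition parallelogram ::
    "real ^ 2 \<Rightarrow> real ^ 2 \<Rightarrow> real ^ 2 \<Rightarrow> real ^ 2 \<Rightarrow> bool"
  where "parallelogram P Q R S \<longleftrightarrow>
    \<not> collinear {P, Q, R} \<and> \<not> collinear {Q, R, S} \<and>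
    \<not> collinear {R, S, P} \<and> \<not> collinear {S, P, Q} \<and>
    affine_parallel (affine hull {P, Q}) (affine hull {R, S}) \<and>
    affine_parallel (affine hull {Q, R}) (affine hull {S, P})"

definition centroid :: "real ^ 2 \<Rightarrow> real ^ 2 \<Rightarrow> real ^ 2 \<Rightarrow> real ^ 2"
  where "centroid P Q R = (1 / 3) *\<^sub>R (P + Q + R)"

text \<open>Signed areas in the standard orientation (counterclockwise positive).\<close>

definition ccw_area3 :: "real ^ 2 \<Rightarrow> real ^ 2 \<Rightarrow> real ^ 2 \<Rightarrow> real"
  where "ccw_area3 X Y Z =
    ((Y $ 1 - X $ 1) * (Z $ 2 - X $ 2) - (Y $ 2 - X $ 2) * (Z $ 1 - X $ 1)) / 2"

definition ccw_area4 ::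
    "real ^ 2 \<Rightarrow> real ^ 2 \<Rightarrow> real ^ 2 \<Rightarrow> real ^ 2 \<Rightarrow> real"
  where "ccw_area4 X Y Z W = ccw_area3 X Y Z + ccw_area3 Z W X"

definition orientation ::
    "real ^ 2 \<Rightarrow> real ^ 2 \<Rightarrow> real ^ 2 \<Rightarrow> real ^ 2 \<Rightarrow> real"
  where "orientation A B C D = sgn (ccw_area4 A B C D)"

text \<open>The signed area \<open>[XYZW]\<close>, counted positive for the orientation \<open>s\<close> (\<open>1\<close> for
  counterclockwise, \<open>-1\<close> for clockwise).\<close>

definition signed_area ::
    "real \<Rightarrow> real ^ 2 \<Rightarrow> real ^ 2 \<Rightarrow> real ^ 2 \<Rightarrow> real ^ 2 \<Rightarrow> real"
  where "signed_area s X Y Z W = s * ccw_area4 X Y Z W"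

lemma same_side_ccw_area3:
  assumes "X \<noteq> Y" "affine hull {X, Y} \<inter> closed_segment Z W = {}"
  shows "ccw_area3 X Y Z * ccw_area3 X Y W > 0"
proof (rule ccontr)
  define p where "p = ccw_area3 X Y Z"
  define q where "q = ccw_area3 X Y W"
  have on_line: "V \<in> affine hull {X, Y}" if "ccw_area3 X Y V = 0" for V
  proof (cases "Y $ 1 = X $ 1")
    case True
    then have ne: "Y $ 2 \<noteq> X $ 2" using assms(1) by (auto simp: vec_eq_iff forall_2)
    define u where "u = (V $ 2 - X $ 2) / (Y $ 2 - X $ 2)"
    have u2: "u * (Y $ 2 - X $ 2) = V $ 2 - X $ 2" using ne by (simp add: u_def)
    have "V $ 1 = X $ 1" using that True ne by (simp add: ccw_area3_def)
    then have "V = (1 - u) *\<^sub>R X + u *\<^sub>R Y"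
      using u2 True by (auto simp: vec_eq_iff forall_2 algebra_simps)
    then show ?thesis unfolding affine_hull_2 by force
  next
    case False
    define u where "u = (V $ 1 - X $ 1) / (Y $ 1 - X $ 1)"
    have u1: "u * (Y $ 1 - X $ 1) = V $ 1 - X $ 1" using False by (simp add: u_def)
    have "(Y $ 1 - X $ 1) * (V $ 2 - X $ 2) = (Y $ 1 - X $ 1) * (u * (Y $ 2 - X $ 2))"
      using that u1 by (simp add: ccw_area3_def) algebra
    then have "V $ 2 - X $ 2 = u * (Y $ 2 - X $ 2)" using False by simp
    then have "V = (1 - u) *\<^sub>R X + u *\<^sub>R Y"
      using u1 by (auto simp: vec_eq_iff forall_2 algebra_simps)
    then show ?thesis unfolding affine_hull_2 by force
  qed
  assume "\<not> ccw_area3 X Y Z * ccw_area3 X Y W > 0"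
  then have pq: "p * q \<le> 0" by (simp add: p_def q_def)
  have "\<exists>t\<in>{0..1}. (1 - t) * p + t * q = 0"
  proof (cases "p = q")
    case True
    then show ?thesis using pq by (intro bexI[of _ 0]) (auto simp: mult_le_0_iff)
  next
    case False
    have "0 \<le> p / (p - q) \<and> p / (p - q) \<le> 1"
      using pq False
      by (auto simp: mult_le_0_iff divide_simps)
    then show ?thesis using False by (intro bexI[of _ "p / (p - q)"]) (auto simp: field_simps)
  qed
  then obtain t where t: "0 \<le> t" "t \<le> 1" "(1 - t) * p + t * q = 0" by auto
  define V where "V = (1 - t) *\<^sub>R Z + t *\<^sub>R W"
  have "ccw_area3 X Y V = (1 - t) * p + t * q"
    by (simp add: V_def ccw_area3_def p_def q_def field_simps)
  then have "V \<in> affine hull {X, Y}" using t on_line by simp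
  moreover have "V \<in> closed_segment Z W" using t by (auto simp: V_def in_segment)
  ultimately show False using assms by blast
qed

lemma convex_quadrilateral_signs:
  assumes "convex_quadrilateral A B C D"
  shows "ccw_area3 A B C * ccw_area3 B C D > 0"
    and "ccw_area3 A B C * ccw_area3 C D A > 0"
    and "ccw_area3 A B C * ccw_area3 D A B > 0"
proof -
  have in_hull: "X \<in> affine hull {X, Y}" for X Y :: "real ^ 2" by (simp add: hull_inc)
  have "A \<noteq> B" "B \<noteq> C" "C \<noteq> D" "D \<noteq> A"
    using assms in_hull[of B C] in_hull[of C D] in_hull[of D A] in_hull[of A B]
    unfolding convex_quadrilateral_def by auto
  then have *: "ccw_area3 A B C * ccw_area3 A B D > 0" "ccw_area3 B C D * ccw_area3 B C A > 0"
      "ccw_area3 C D A * ccw_area3 C D B > 0"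
    using assms unfolding convex_quadrilateral_def by (simp_all add: same_side_ccw_area3)
  have "ccw_area3 B C A = ccw_area3 A B C" "ccw_area3 A B D = ccw_area3 D A B"
      "ccw_area3 C D B = ccw_area3 B C D"
    by (simp_all add: ccw_area3_def algebra_simps)
  with * show "ccw_area3 A B C * ccw_area3 B C D > 0" "ccw_area3 A B C * ccw_area3 C D A > 0"
      "ccw_area3 A B C * ccw_area3 D A B > 0"
    by (auto simp: zero_less_mult_iff)
qed

lemma convex_hull_4_split:
  fixes A B C D :: "real ^ 2"
  assumes rel: "a *\<^sub>R A + c *\<^sub>R C = b *\<^sub>R B + d *\<^sub>R D"
    and pos: "a > 0" "b > 0" "c > 0" "d > 0" and sum: "a + c = b + d"
  shows "convex hull {A, B, C, D} = convex hull {A, B, C} \<union> convex hull {C, D, A}"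
proof (rule antisym)
  show "convex hull {A, B, C} \<union> convex hull {C, D, A} \<subseteq> convex hull {A, B, C, D}"
    by (intro Un_least hull_mono) auto
  show "convex hull {A, B, C, D} \<subseteq> convex hull {A, B, C} \<union> convex hull {C, D, A}"
  proof
    fix x assume "x \<in> convex hull {A, B, C, D}"
    then obtain u0 u1 y where u: "u0 \<ge> 0" "u1 \<ge> 0" "u0 + u1 = 1" "y \<in> convex hull {B, C, D}"
        and x0: "x = u0 *\<^sub>R A + u1 *\<^sub>R y"
      using convex_hull_insert[of "{B, C, D}" A] by auto
    from u(4) obtain v0 v1 v2 where v: "v0 \<ge> 0" "v1 \<ge> 0" "v2 \<ge> 0" "v0 + v1 + v2 = 1"
        and y0: "y = v0 *\<^sub>R B + v1 *\<^sub>R C + v2 *\<^sub>R D"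
      unfolding convex_hull_3 by blast
    define p q r where "p = u1 * v0" and "q = u1 * v1" and "r = u1 * v2"
    have nn: "p \<ge> 0" "q \<ge> 0" "r \<ge> 0" using u v by (simp_all add: p_def q_def r_def)
    have "p + q + r = u1 * (v0 + v1 + v2)" by (simp add: p_def q_def r_def algebra_simps)
    then have s: "u0 + p + q + r = 1" using u v by simp
    have x: "x = u0 *\<^sub>R A + p *\<^sub>R B + q *\<^sub>R C + r *\<^sub>R D"
      by (simp add: x0 y0 p_def q_def r_def algebra_simps)
    show "x \<in> convex hull {A, B, C} \<union> convex hull {C, D, A}"
    proof (cases "r / d \<le> p / b")
      case True
      define k where "k = r / d"
      have r: "r = k * d" using pos by (simp add: k_def)
      have k: "k \<ge> 0" "k * b \<le> p" using True nn pos by (auto simp: k_def field_simps)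
      have "x = (u0 + k * a) *\<^sub>R A + (p - k * b) *\<^sub>R B + (q + k * c) *\<^sub>R C
          - k *\<^sub>R (a *\<^sub>R A + c *\<^sub>R C - (b *\<^sub>R B + d *\<^sub>R D))"
        unfolding x r by (simp add: algebra_simps)
      then have "x = (u0 + k * a) *\<^sub>R A + (p - k * b) *\<^sub>R B + (q + k * c) *\<^sub>R C"
        using rel by simp
      moreover have "(u0 + k * a) + (p - k * b) + (q + k * c) = 1"
        using s sum unfolding r by algebra
      moreover have "u0 + k * a \<ge> 0" "p - k * b \<ge> 0" "q + k * c \<ge> 0"
        using k nn u pos by auto
      ultimately show ?thesis unfolding convex_hull_3 by blast
    next
      case False
      define k where "k = p / b"
      have p: "p = k * b" using pos by (simp add: k_def)
      have k: "k \<ge> 0" "k * d \<le> r" using False nn pos by (auto simp: k_def field_simps)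
      have "x = (q + k * c) *\<^sub>R C + (r - k * d) *\<^sub>R D + (u0 + k * a) *\<^sub>R A
          - k *\<^sub>R (a *\<^sub>R A + c *\<^sub>R C - (b *\<^sub>R B + d *\<^sub>R D))"
        unfolding x p by (simp add: algebra_simps)
      then have "x = (q + k * c) *\<^sub>R C + (r - k * d) *\<^sub>R D + (u0 + k * a) *\<^sub>R A"
        using rel by simp
      moreover have "(q + k * c) + (r - k * d) + (u0 + k * a) = 1"
        using s sum unfolding p by algebra
      moreover have "u0 + k * a \<ge> 0" "r - k * d \<ge> 0" "q + k * c \<ge> 0"
        using k nn u pos by auto
      ultimately show ?thesis unfolding convex_hull_3 by blast
    qed
  qed
qed

lemma measure_triangle: "measure lebesgue (convex hull {A, B, C}) = \<bar>ccw_area3 A B C\<bar>"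
proof -
  have "compact (convex hull {A, B, C})" by (intro finite_imp_compact_convex_hull) auto
  then have "measure lebesgue (convex hull {A, B, C}) = measure lborel (convex hull {A, B, C})"
    by (intro measure_completion) (auto dest: compact_imp_closed)
  then show ?thesis
    unfolding content_triangle ccw_area3_def by (simp add: abs_minus_commute algebra_simps)
qed

text \<open>For a convex quadrilateral the signed area is the actual area of the region it bounds.\<close>

lemma signed_area_convex_quadrilateral:
  assumes "convex_quadrilateral A B C D"
  shows "signed_area (orientation A B C D) A B C D = measure lebesgue (convex hull {A, B, C, D})"
proof -
  define a b c d where "a = \<bar>ccw_area3 B C D\<bar>" and "b = \<bar>ccw_area3 C D A\<bar>"
    and "c = \<bar>ccw_area3 D A B\<bar>" and "d = \<bar>ccw_area3 A B C\<bar>"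
  note signs = convex_quadrilateral_signs[OF assms]
  have pos: "a > 0" "b > 0" "c > 0" "d > 0"
    using signs by (auto simp: a_def b_def c_def d_def)
  have "\<exists>s. (s = 1 \<or> s = -1) \<and> a = s * ccw_area3 B C D \<and> b = s * ccw_area3 C D A \<and>
      c = s * ccw_area3 D A B \<and> d = s * ccw_area3 A B C"
    using signs by (intro exI[of _ "sgn (ccw_area3 A B C)"])
      (auto simp: a_def b_def c_def d_def zero_less_mult_iff)
  then obtain s where s: "s = 1 \<or> s = -1" "a = s * ccw_area3 B C D" "b = s * ccw_area3 C D A"
      "c = s * ccw_area3 D A B" "d = s * ccw_area3 A B C" by blast
  have sum: "a + c = b + d" unfolding s(2-5) ccw_area3_def by (simp add: algebra_simps add_divide_distrib diff_divide_distrib)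
  have rel: "a *\<^sub>R A + c *\<^sub>R C = b *\<^sub>R B + d *\<^sub>R D"
    unfolding s(2-5) ccw_area3_def by (simp add: vec_eq_iff forall_2 algebra_simps add_divide_distrib diff_divide_distrib)
  let ?T1 = "convex hull {A, B, C}" and ?T2 = "convex hull {C, D, A}"
  have meas: "?T1 \<in> lmeasurable" "?T2 \<in> lmeasurable"
    by (auto intro!: lmeasurable_compact finite_imp_compact_convex_hull)
  have half: "s * ccw_area3 A C x \<le> 0" if xT: "x \<in> ?T1" for x
  proof -
    obtain u v w where "v \<ge> 0" and "u + v + w = 1" and x: "x = u *\<^sub>R A + v *\<^sub>R B + w *\<^sub>R C"
      using xT unfolding convex_hull_3 by blast
    then have u: "u = 1 - v - w" by simp
    have "s * ccw_area3 A C x = - (v * d)"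
      unfolding x u s(5) by (simp add: ccw_area3_def field_simps)
    then show ?thesis using \<open>v \<ge> 0\<close> pos by simp
  qed
  have half': "s * ccw_area3 A C x \<ge> 0" if xT: "x \<in> ?T2" for x
  proof -
    obtain u v w where "v \<ge> 0" and "u + v + w = 1" and x: "x = u *\<^sub>R C + v *\<^sub>R D + w *\<^sub>R A"
      using xT unfolding convex_hull_3 by blast
    then have u: "u = 1 - v - w" by simp
    have "s * ccw_area3 A C x = v * b"
      unfolding x u s(3) by (simp add: ccw_area3_def field_simps)
    then show ?thesis using \<open>v \<ge> 0\<close> pos by simp
  qed
  define n :: "real ^ 2" where "n = vector [A $ 2 - C $ 2, C $ 1 - A $ 1]"
  have n: "ccw_area3 A C x = 0 \<longleftrightarrow> n \<bullet> x = n \<bullet> A" for x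
    by (auto simp: ccw_area3_def n_def inner_vec_def sum_2 vector_2 algebra_simps)
  have "A \<noteq> C" using pos by (auto simp: d_def ccw_area3_def)
  then have "n \<noteq> 0" by (auto simp: n_def vec_eq_iff forall_2 vector_2)
  have "?T1 \<inter> ?T2 \<subseteq> {x. n \<bullet> x = n \<bullet> A}"
  proof
    fix x assume "x \<in> ?T1 \<inter> ?T2"
    then have "s * ccw_area3 A C x = 0" using half[of x] half'[of x] by simp
    then show "x \<in> {x. n \<bullet> x = n \<bullet> A}" using s(1) n[of x] by auto
  qed
  moreover have "negligible {x. n \<bullet> x = n \<bullet> A}" using \<open>n \<noteq> 0\<close> by (intro negligible_hyperplane) auto
  ultimately have "negligible (?T1 \<inter> ?T2)" by (rule negligible_subset[rotated])
  then have "measure lebesgue (?T1 \<inter> ?T2) = 0" by (rule negligible_imp_measure0)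
  then have "measure lebesgue (?T1 \<union> ?T2) = d + b"
    using measure_Un3[OF meas] by (simp add: measure_triangle b_def d_def)
  then have "measure lebesgue (convex hull {A, B, C, D}) = d + b"
    using convex_hull_4_split[OF rel pos sum] by simp
  moreover have "signed_area (orientation A B C D) A B C D = d + b"
  proof -
    have "signed_area (orientation A B C D) A B C D = \<bar>ccw_area4 A B C D\<bar>"
      by (simp add: signed_area_def orientation_def abs_sgn mult.commute)
    also have "\<dots> = d + b"
      using signs(2) by (auto simp: ccw_area4_def b_def d_def zero_less_mult_iff)
    finally show ?thesis .
  qed
  ultimately show ?thesis by simp
qed

end

theory Submission
  imports Defs
begin

text \<open>Each side of \<open>FGHI\<close> joins the centroids of two triangles that share \<open>E\<close> and a vertex of
  \<open>ABCD\<close>, so both cancel in the difference: \<open>G - F = (C - A) / 3 = H - I\<close> and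
  \<open>H - G = (D - B) / 3 = I - F\<close>.  Hence \<open>FGHI\<close> is a translate of a figure that does not
  depend on \<open>E\<close>, with sides parallel to the diagonals of \<open>ABCD\<close> and a third as long.

  Write \<open>\<times>\<close> for the planar cross product.  The area of \<open>ABCD\<close> is half that of the parallelogram
  spanned by its diagonals, \<open>(C - A) \<times> (D - B) / 2\<close>, while that of \<open>FGHI\<close> is
  \<open>(C - A) \<times> (D - B) / 9\<close>; the ratio is \<open>9 / 2\<close>.  Convexity gives \<open>ABCD\<close> nonzero area, so the
  same formula shows that \<open>FGHI\<close> is not flat.\<close>

lemma collinear_imp_ccw_area3_eq_0:
  assumes "collinear {X, Y, Z}"
  shows "ccw_area3 X Y Z = 0"
proof -
  obtain u c d where "Y - X = c *\<^sub>R u" "Z - X = d *\<^sub>R u"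
    using assms unfolding collinear_def by blast
  then have "Y = X + c *\<^sub>R u" "Z = X + d *\<^sub>R u"
    by (simp_all add: algebra_simps)
  then show ?thesis
    by (simp add: ccw_area3_def)
qed

text \<open>The translation by \<open>S - P\<close> carries \<open>P\<close> to \<open>S\<close> and \<open>Q\<close> to \<open>R\<close>.\<close>

lemma affine_parallel_if_equal_differences:
  fixes P Q R S :: "'a::real_vector"
  assumes "Q - P = R - S"
  shows "affine_parallel (affine hull {P, Q}) (affine hull {R, S})"
proof -
  have "{R, S} = (+) (S - P) ` {P, Q}"
    using assms by (auto simp: algebra_simps)
  then have "affine hull {R, S} = (+) (S - P) ` (affine hull {P, Q})"
    by (simp only: affine_hull_translation)
  then show ?thesis
    unfolding affine_parallel_def by blast
qed

text \<open>One pair of equal opposite sides forces the other, and then all four triangles on three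
  consecutive vertices have the same area, so it is enough that one of them is not flat.\<close>

lemma parallelogramI:
  assumes side: "Q - P = R - S" and area: "ccw_area3 P Q R \<noteq> 0"
  shows "parallelogram P Q R S"
proof -
  have S: "S = P + R - Q"
    using side by (simp add: algebra_simps)
  have "ccw_area3 Q R S = ccw_area3 P Q R" "ccw_area3 R S P = ccw_area3 P Q R"
    "ccw_area3 S P Q = ccw_area3 P Q R"
    unfolding S by (simp_all add: ccw_area3_def algebra_simps)
  then have "\<not> collinear {P, Q, R}" "\<not> collinear {Q, R, S}"
    "\<not> collinear {R, S, P}" "\<not> collinear {S, P, Q}"
    using area by (metis collinear_imp_ccw_area3_eq_0)+
  moreover have "R - Q = S - P"
    using side by (simp add: algebra_simps)
  ultimately show ?thesis
    unfolding parallelogram_def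
    using side affine_parallel_if_equal_differences by blast
qed

text \<open>Triangles \<open>ABC\<close> and \<open>CDA\<close> are similarly oriented, so their signed areas do not cancel.\<close>

lemma convex_quadrilateral_area_nonzero:
  assumes "convex_quadrilateral A B C D"
  shows "ccw_area4 A B C D \<noteq> 0"
  using convex_quadrilateral_signs(2)[OF assms]
  by (auto simp: ccw_area4_def zero_less_mult_iff)

text \<open>Each half of \<open>FGHI\<close> cut off by the diagonal \<open>FH\<close> is half of the parallelogram spanned by
  \<open>(C - A) / 3\<close> and \<open>(D - B) / 3\<close>, whereas \<open>[ABCD]\<close> is half of the one spanned by \<open>C - A\<close>
  and \<open>D - B\<close>.\<close>

lemma centroid_triangle_areas:
  "ccw_area3 (centroid E A B) (centroid E B C) (centroid E C D) = ccw_area4 A B C D / 9"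
  "ccw_area3 (centroid E C D) (centroid E D A) (centroid E A B) = ccw_area4 A B C D / 9"
  by (simp_all add: ccw_area4_def ccw_area3_def centroid_def field_simps)

theorem theorem6p1:
  fixes A B C D E F G H I :: "real ^ 2"
  assumes "convex_quadrilateral A B C D"
    and "E \<notin> affine hull {A, B}"
    and "E \<notin> affine hull {B, C}"
    and "E \<notin> affine hull {C, D}"
    and "E \<notin> affine hull {D, A}"
    and "F = centroid E A B"
    and "G = centroid E B C"
    and "H = centroid E C D"
    and "I = centroid E D A"
  shows "parallelogram F G H I \<and>
    signed_area (orientation A B C D) A B C D =
      9 / 2 * signed_area (orientation A B C D) F G H I"
proof
  have halves: "ccw_area3 F G H = ccw_area4 A B C D / 9" "ccw_area3 H I F = ccw_area4 A B C D / 9"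
    unfolding assms(6-9) by (rule centroid_triangle_areas)+
  show "parallelogram F G H I"
  proof (rule parallelogramI)
    show "G - F = H - I"
      unfolding assms(6-9) centroid_def by (simp add: algebra_simps)
    show "ccw_area3 F G H \<noteq> 0"
      using halves(1) convex_quadrilateral_area_nonzero[OF assms(1)] by simp
  qed
  show "signed_area (orientation A B C D) A B C D =
      9 / 2 * signed_area (orientation A B C D) F G H I"
    using halves by (simp add: signed_area_def ccw_area4_def[of F G H I])
qed

end
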